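(* There exists a multiplicative Sidon set $A\subseteq\mathbb{N}$ such that $$\liminf_{n\to\infty}\frac{|A(n)|-\pi(n)}{\frac{n^{3/4}}{(\log n)^3}}>\frac{1}{196608}.$$
   Context: A set $A$ of positive integers is called a multiplicative Sidon set if for every integer $s$ the equation $xy=s$ has at most one solution $(x,y)$ with $x,y\in A$, up to ordering of $x$ and $y$. For a positive integer $n$, $[n]=\{1,2,\dots,n\}$ and $A(n)=A\cap[n]$; $|A(n)|$ denotes its cardinality. $\pi(n)$ denotes the number of primes not exceeding $n$, and $\log$ is the natural logarithm. *)

theory Defs
  imports "HOL-Analysis.Analysis" "HOL-Computational_Algebra.Primes"
begin

definition multiplicative_Sidon :: "nat set \<Rightarrow> bool" where
  "multiplicative_Sidon A \<longleftrightarrow>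
     A \<subseteq> {0<..} \<and>
     (\<forall>s::nat. \<forall>x\<in>A. \<forall>y\<in>A. \<forall>u\<in>A. \<forall>v\<in>A.
        x * y = s \<and> u * v = s \<longrightarrow> (x = u \<and> y = v) \<or> (x = v \<and> y = u))"

definition counting :: "nat set \<Rightarrow> nat \<Rightarrow> nat" where
  "counting A n = card (A \<inter> {1..n})"

definition prime_counting :: "nat \<Rightarrow> nat" where
  "prime_counting n = card {p::nat. prime p \<and> p \<le> n}"

end

theory Submission
  imports Defs
begin

text \<open>
  Keep all primes and add products of four primes. For a scale \<open>N = 2 ^ i\<close> split a block of \<open>4N\<close>
  consecutive primes into four classes of size \<open>N\<close>, pick a prime \<open>q\<close> with \<open>8N < q \<le> 32N\<close>, and use
  the products of \<open>p\<^sub>a\<close>, \<open>p\<^sub>b\<close>, \<open>p\<^sub>c\<close>, \<open>p\<^sub>d\<close> from the four classes whose indices satisfy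
  \<open>a (b + c) + b\<^sup>2 - c\<^sup>2 - d \<equiv> t\<close> modulo \<open>q\<close>; some \<open>t\<close> gives at least \<open>N ^ 4 / q\<close> of them.
  By unique factorization, a coincidence \<open>x y = u v\<close> exchanges coordinates between two points of
  the surface. The alternating sum of the equation over such a rectangle is \<open>(a - a') (c - c')\<close> or
  \<open>(a - a') (b - b')\<close> for two of the three pairings; for the third it gives \<open>b + c = b' + c'\<close>, and
  then \<open>b\<^sup>2 - c\<^sup>2 = b'\<^sup>2 - c'\<^sup>2\<close> forces \<open>b = b'\<close>. So no nontrivial exchange exists, and no
  prime has to be removed.

  If \<open>16 ^ k \<le> n < 16 ^ (k + 1)\<close>, Chebyshev's bound \<open>k \<pi>(2 ^ k) \<ge> 2 ^ k - 1\<close> allows a scale with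
  \<open>16 k N \<ge> 2 ^ k\<close> all of whose primes are at most \<open>2 ^ k\<close>, which contributes at least \<open>N ^ 3 / 32\<close>
  elements up to \<open>n\<close>. This makes the quotient at least \<open>1 / 65536\<close> for large \<open>n\<close>.
\<close>

section \<open>Chebyshev bounds at powers of two\<close>

text \<open>Induction along the Leibniz harmonic triangle:
  \<open>1 / (m C(n, m)) = 1 / (m C(n - 1, m)) - 1 / ((m + 1) C(n, m + 1))\<close>.\<close>

lemma dvd_mult_binomial_of_dvd_all:
  fixes D :: nat
  assumes "\<And>x. 1 \<le> x \<Longrightarrow> x \<le> n \<Longrightarrow> x dvd D" "1 \<le> m" "m + j \<le> n"
  shows "m * ((m + j) choose m) dvd D"
  using assms(2,3)
proof (induction j arbitrary: m)
  case 0
  then show ?case using assms(1) by simp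
next
  case (Suc j)
  define c where "c = (m + j) choose m"
  define z where "z = m * ((m + Suc j) choose m)"
  have cpos: "c > 0" by (simp add: c_def)
  have "m * c dvd D"
    using Suc.IH[of m] Suc.prems by (simp add: c_def)
  then obtain a where a: "D = m * c * a" by (auto elim: dvdE)
  have y: "Suc m * ((Suc m + j) choose Suc m) = (m + j + 1) * c"
    using Suc_times_binomial[of m "m + j"] by (simp add: c_def)
  have "(m + j + 1) * c dvd D"
    using Suc.IH[of "Suc m"] Suc.prems y by simp
  then obtain b where b: "D = (m + j + 1) * c * b" by (auto elim: dvdE)
  have z: "z * (j + 1) = m * (m + j + 1) * c"
  proof -
    have "Suc j * (Suc (m + j) choose Suc j) = Suc (m + j) * (m + j choose j)"
      by (rule Suc_times_binomial)
    moreover have "(Suc (m + j) choose Suc j) = (Suc (m + j) choose m)"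
      using binomial_symmetric[of "Suc j" "Suc (m + j)"] by simp
    moreover have "(m + j choose j) = c"
      using binomial_symmetric[of j "m + j"] by (simp add: c_def)
    ultimately have "Suc j * (Suc (m + j) choose m) = Suc (m + j) * c"
      by simp
    then show ?thesis
      by (simp add: z_def algebra_simps)
  qed
  \<comment> \<open>Since \<open>a = D / (m * c)\<close> and
    \<open>b = D / ((m + j + 1) * c)\<close>, this is \<open>D\<close> times the Leibniz identity
    with denominators cleared: the cofactor of \<open>z\<close> in \<open>D\<close> is
    \<open>a - b\<close>. The subtraction is the reason for passing to integers.\<close>
  have "int D * int (j + 1) = int z * (int a - int b) * int (j + 1)"
  proof -
    have "int D * int (j + 1) = int D * int (m + j + 1) - int D * int m"
      by (simp add: algebra_simps)
    also have "\<dots> = int (m * c * a) * int (m + j + 1) - int ((m + j + 1) * c * b) * int m"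
      using a b by simp
    also have "\<dots> = int (m * (m + j + 1) * c) * (int a - int b)"
      by (simp only: of_nat_mult) (simp only: algebra_simps)
    also have "\<dots> = int z * (int a - int b) * int (j + 1)"
      unfolding z[symmetric] by (simp only: of_nat_mult) (simp only: algebra_simps)
    finally show ?thesis .
  qed
  then have "int D = int z * (int a - int b)"
    by (simp del: of_nat_add of_nat_Suc)
  then have "int z dvd int D" by (metis dvd_triv_left)
  then show ?case by (simp only: z_def int_dvd_int_iff)
qed

lemma finite_primes_le [simp]: "finite {p::nat. prime p \<and> p \<le> n}"
  by (rule finite_subset[of _ "{..n}"]) auto

text \<open>The witness is lcm(1, ..., n), written as the product of the largest prime powers not
  exceeding \<open>n\<close>: one factor for each prime up to \<open>n\<close>, each factor at most
  \<open>n\<close>.\<close>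

lemma common_multiple_le_power_prime_counting:
  assumes "n > 0"
  obtains D :: nat where "D > 0" "D \<le> n ^ prime_counting n"
    "\<And>x. 1 \<le> x \<Longrightarrow> x \<le> n \<Longrightarrow> x dvd D"
proof -
  define e where "e = (\<lambda>p::nat. GREATEST e. p ^ e \<le> n)"
  define Q where "Q = {p::nat. prime p \<and> p \<le> n}"
  \<comment> \<open>The inequality \<open>k < p ^ k\<close> bounds the admissible exponents, so that
    \<open>GREATEST\<close> really denotes a maximum.\<close>
  have bnd: "k \<le> n" if "p ^ k \<le> n" "p \<in> Q" for p k
  proof -
    have "k < p ^ k" using that(2) prime_gt_1_nat[of p] by (intro power_gt_expt) (auto simp: Q_def)
    then show ?thesis using that(1) by simp
  qed
  have e1: "p ^ e p \<le> n" if "p \<in> Q" for p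
    unfolding e_def by (rule GreatestI_nat[of _ 0 n]) (use assms bnd that in auto)
  have e2: "k \<le> e p" if "p ^ k \<le> n" "p \<in> Q" for p k
    unfolding e_def by (rule Greatest_le_nat[of _ k n]) (use bnd that in auto)
  define D where "D = (\<Prod>p\<in>Q. p ^ e p)"
  have fin: "finite Q" by (simp add: Q_def)
  show ?thesis
  proof (rule that[of D])
    show "D > 0" unfolding D_def by (rule prod_pos) (auto simp: Q_def prime_gt_0_nat)
    have "D \<le> (\<Prod>p\<in>Q. n)"
      unfolding D_def by (rule prod_mono) (use e1 in auto)
    then show "D \<le> n ^ prime_counting n"
      by (simp add: prime_counting_def Q_def)
  next
    fix x :: nat assume x: "1 \<le> x" "x \<le> n"
    have le: "p ^ multiplicity p x \<le> n" for p
      using x dvd_imp_le[OF multiplicity_dvd[of p x]] by simp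
    have "x = (\<Prod>p\<in>prime_factors x. p ^ multiplicity p x)"
      using x by (intro prime_factorization_nat) simp
    also have "\<dots> dvd D"
      unfolding D_def
    proof (rule prod_dvd_prod_subset2[OF fin])
      show sub: "prime_factors x \<subseteq> Q"
        using x by (auto simp: Q_def prime_factors_dvd dest: dvd_imp_le)
      show "p ^ multiplicity p x dvd p ^ e p" if "p \<in> prime_factors x" for p
        using sub that e2[OF le] by (intro le_imp_power_dvd) auto
    qed
    finally show "x dvd D" .
  qed
qed

text \<open>With 2m = 2^k, the number m C(2m, m) divides some D <= 2^(k pi(2^k)), while 4^m <= 2 m
  C(2m, m). Comparing exponents of 2 gives the bound; the extra factor 2 becomes the
  \<open>+ 1\<close>.\<close>

lemma prime_counting_two_power_lower:
  assumes "k \<ge> 1"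
  shows "2 ^ k \<le> k * prime_counting (2 ^ k) + 1"
proof -
  define m :: nat where "m = 2 ^ (k - 1)"
  have m: "2 * m = 2 ^ k" "m \<ge> 1"
    using assms by (auto simp: m_def simp flip: power_Suc)
  obtain D :: nat where D: "D > 0" "D \<le> (2 ^ k) ^ prime_counting (2 ^ k)"
    "\<And>x. 1 \<le> x \<Longrightarrow> x \<le> 2 ^ k \<Longrightarrow> x dvd D"
    using common_multiple_le_power_prime_counting[of "2 ^ k"] by auto
  have "m * ((m + m) choose m) dvd D"
    by (rule dvd_mult_binomial_of_dvd_all[of "2 ^ k"]) (use D m in auto)
  then have "m * ((2 * m) choose m) \<le> D"
    using D(1) by (simp add: dvd_imp_le mult_2)
  moreover have "4 ^ m / (2 * real m) \<le> real ((2 * m) choose m)"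
    by (rule central_binomial_lower_bound) (use m in simp)
  then have "4 ^ m \<le> 2 * real (m * ((2 * m) choose m))"
    using m by (simp add: field_simps)
  ultimately have "(4::real) ^ m \<le> 2 * real D"
    by (smt (verit) of_nat_le_iff)
  then have "real (4 ^ m) \<le> real (2 * D)" by simp
  then have "(4::nat) ^ m \<le> 2 * D" by (simp only: of_nat_le_iff)
  also have "\<dots> \<le> 2 * (2 ^ k) ^ prime_counting (2 ^ k)" using D by simp
  finally have "(2::nat) ^ (2 * m) \<le> 2 ^ (k * prime_counting (2 ^ k) + 1)"
    by (simp add: power_mult)
  then show ?thesis using m by (simp only: power_increasing_iff)
qed

section \<open>Chebyshev upper bound and primes between powers of two\<close>

lemma prod_primes_dvd:
  fixes x :: nat
  assumes "finite Q" "\<And>p. p \<in> Q \<Longrightarrow> prime p" "\<And>p. p \<in> Q \<Longrightarrow> p dvd x"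
  shows "\<Prod>Q dvd x"
  using assms
proof (induction Q rule: finite_induct)
  case (insert p Q)
  have "coprime p (\<Prod>Q)"
    using insert by (intro prod_coprime_right) (auto intro!: primes_coprime)
  then show ?case using insert by (simp add: divides_mult)
qed simp

text \<open>A prime in (n, 2n] divides (2n)! but not n!, hence divides C(2n, n), which is at most
  4^n.\<close>

lemma card_primes_interval_upper:
  "n ^ card {p::nat. prime p \<and> n < p \<and> p \<le> 2 * n} \<le> 4 ^ n"
proof -
  define Q where "Q = {p::nat. prime p \<and> n < p \<and> p \<le> 2 * n}"
  have fin: "finite Q" by (rule finite_subset[of _ "{..2*n}"]) (auto simp: Q_def)
  have "\<Prod>Q dvd ((2 * n) choose n)"
  proof (rule prod_primes_dvd[OF fin])
    fix p assume p: "p \<in> Q"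
    then show "prime p" by (simp add: Q_def)
    have "p dvd fact (2 * n)" using p by (simp add: Q_def prime_dvd_fact_iff)
    also have "fact (2 * n) = fact n * fact n * ((2 * n) choose n)"
      using binomial_fact_lemma[of n "2 * n"] by simp
    finally show "p dvd ((2 * n) choose n)"
      using p by (auto simp: Q_def prime_dvd_mult_iff prime_dvd_fact_iff)
  qed
  then have "\<Prod>Q \<le> (2 * n) choose n"
    by (rule dvd_imp_le) simp
  also have "\<dots> \<le> 2 ^ (2 * n)" by (rule binomial_le_pow2)
  finally have "\<Prod>Q \<le> 4 ^ n" by (simp add: power_mult)
  moreover have "n ^ card Q \<le> \<Prod>Q"
    using prod_mono[of Q "\<lambda>_. n" "\<lambda>p. p"] by (auto simp: Q_def)
  ultimately show ?thesis by (simp add: Q_def)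
qed

text \<open>Doubling raises the bound for k pi from 3 * 2^k to at most (3 + 2) * 2^k. Replacing k by
  k + 1 costs a factor of at most 6/5 once k >= 5, and 6 * 2^k = 3 * 2^(k + 1) closes the
  induction.\<close>

lemma prime_counting_two_power_upper:
  assumes "k \<ge> 5"
  shows "k * prime_counting (2 ^ k) \<le> 3 * 2 ^ k"
  using assms
proof (induction k rule: dec_induct)
  case base
  \<comment> \<open>Only 2 and the 16 odd numbers up to 31 can be prime, and 5 * 17 = 85 <= 96 = 3 *
    32.\<close>
  have "{p::nat. prime p \<and> p \<le> 32} \<subseteq> insert 2 ((\<lambda>j. 2 * j + 1) ` {..<16})"
  proof
    fix p :: nat assume "p \<in> {p. prime p \<and> p \<le> 32}"
    then have p: "prime p" "p \<le> 32" by auto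
    show "p \<in> insert 2 ((\<lambda>j. 2 * j + 1) ` {..<16})"
    proof (cases "p = 2")
      case False
      then have "odd p" using p(1) primes_dvd_imp_eq two_is_prime_nat by blast
      then show ?thesis using p(2) by (auto elim!: oddE)
    qed simp
  qed
  then have "card {p::nat. prime p \<and> p \<le> 32} \<le> card (insert 2 ((\<lambda>j::nat. 2 * j + 1) ` {..<16}))"
    by (intro card_mono) auto
  also have "\<dots> \<le> Suc (card ((\<lambda>j::nat. 2 * j + 1) ` {..<16}))" by (rule card_insert_le_m1) auto
  also have "card ((\<lambda>j::nat. 2 * j + 1) ` {..<16}) \<le> 16"
    using card_image_le[of "{..<16::nat}"] by simp
  finally show ?case by (simp add: prime_counting_def)
next
  case (step k)
  define c where "c = card {p::nat. prime p \<and> 2 ^ k < p \<and> p \<le> 2 * 2 ^ k}"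
  have fin: "finite {p::nat. prime p \<and> 2 ^ k < p \<and> p \<le> 2 * 2 ^ k}"
    by (rule finite_subset[of _ "{..2 * 2 ^ k}"]) auto
  have "{p::nat. prime p \<and> p \<le> 2 ^ Suc k} =
      {p. prime p \<and> p \<le> 2 ^ k} \<union> {p. prime p \<and> 2 ^ k < p \<and> p \<le> 2 * 2 ^ k}"
    by auto
  then have eq: "prime_counting (2 ^ Suc k) = prime_counting (2 ^ k) + c"
    unfolding prime_counting_def c_def by (subst card_Un_disjoint[symmetric]) (use fin in auto)
  have "(2::nat) ^ (k * c) \<le> 2 ^ (2 * 2 ^ k)"
    using card_primes_interval_upper[of "2 ^ k"] unfolding c_def by (simp add: power_mult)
  then have c: "k * c \<le> 2 * 2 ^ k" by (simp only: power_increasing_iff)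
  have "k * prime_counting (2 ^ Suc k) \<le> 5 * 2 ^ k"
    using step.IH c by (simp only: eq distrib_left)
  moreover have "5 * Suc k \<le> 6 * k" using step by simp
  ultimately have "k * (5 * (Suc k * prime_counting (2 ^ Suc k))) \<le> k * (30 * 2 ^ k)"
  proof -
    assume a: "k * prime_counting (2 ^ Suc k) \<le> 5 * 2 ^ k" and b: "5 * Suc k \<le> 6 * k"
    have "(5 * Suc k) * (k * prime_counting (2 ^ Suc k)) \<le> (6 * k) * (5 * 2 ^ k)"
      by (rule mult_le_mono[OF b a])
    then show ?thesis by (simp only: algebra_simps)
  qed
  then have "5 * (Suc k * prime_counting (2 ^ Suc k)) \<le> 30 * 2 ^ k"
    using step by (simp only: mult_le_cancel1)
  then show ?case by simp
qed

text \<open>The leading constants in the two bounds for k pi(2^k) are 1 and 3, so a window of ratio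
  4 suffices: without a prime in it, the lower bound at 2^(k + 2) and the upper bound at 2^k would
  constrain the same number.\<close>

lemma prime_between_two_powers:
  assumes "k \<ge> 7"
  obtains q :: nat where "prime q" "2 ^ k < q" "q \<le> 2 ^ (k + 2)"
proof (rule ccontr)
  assume "\<not> thesis"
  then have "{p::nat. prime p \<and> p \<le> 2 ^ (k + 2)} = {p. prime p \<and> p \<le> 2 ^ k}"
    using that by (auto simp: not_less[symmetric] intro: order_trans)
  then have eq: "prime_counting (2 ^ (k + 2)) = prime_counting (2 ^ k)"
    by (simp add: prime_counting_def)
  define x where "x = prime_counting (2 ^ k)"
  have l: "4 * 2 ^ k \<le> (k + 2) * x + 1"
    using prime_counting_two_power_lower[of "k + 2"] eq by (simp add: x_def)
  have u: "k * x \<le> 3 * 2 ^ k"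
    using prime_counting_two_power_upper[of k] assms by (simp add: x_def)
  have "k * (4 * 2 ^ k) \<le> k * ((k + 2) * x + 1)" by (rule mult_le_mono2[OF l])
  also have "\<dots> = (k + 2) * (k * x) + k" by (simp add: algebra_simps)
  also have "\<dots> \<le> (k + 2) * (3 * 2 ^ k) + k" using u by (intro add_mono mult_le_mono2) auto
  finally have "k * 2 ^ k \<le> 6 * 2 ^ k + k" by (simp add: algebra_simps)
  moreover have "7 * 2 ^ k \<le> k * 2 ^ k" using assms by simp
  moreover have "k < 2 ^ k" by simp
  ultimately show False by linarith
qed

section \<open>Exchange-free surfaces over a prime field\<close>

text \<open>The shifts \<open>a + 2N\<close> and \<open>b + 1\<close> keep the factors \<open>b + c\<close>, \<open>a + b + b'\<close> and
  \<open>a - c - c'\<close> strictly between \<open>0\<close> and the prime modulus, hence invertible.\<close>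

definition surface :: "nat \<Rightarrow> nat \<Rightarrow> nat \<Rightarrow> nat \<Rightarrow> nat \<Rightarrow> int" where
  "surface N a b c d =
     (int a + 2 * int N) * (int b + 1 + int c) + (int b + 1)^2 - (int c)^2 - int d"

definition surface_points :: "nat \<Rightarrow> nat \<Rightarrow> int \<Rightarrow> (nat \<times> nat \<times> nat \<times> nat) set" where
  "surface_points N q t =
     {(a, b, c, d). a < N \<and> b < N \<and> c < N \<and> d < N \<and> surface N a b c d mod int q = t}"

text \<open>The coordinate conditions exclude \<open>p x = q y\<close> with primes \<open>p\<close>, \<open>q\<close>; the last condition
  excludes swapping two of the four coordinates, for each of the three ways of pairing them up.\<close>

definition exchange_free :: "nat \<Rightarrow> (nat \<times> nat \<times> nat \<times> nat) set \<Rightarrow> bool" where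
  "exchange_free N S \<longleftrightarrow>
     S \<subseteq> {..<N} \<times> {..<N} \<times> {..<N} \<times> {..<N} \<and>
     (\<forall>a b c d a'. (a,b,c,d) \<in> S \<and> (a',b,c,d) \<in> S \<longrightarrow> a = a') \<and>
     (\<forall>a b c d b'. (a,b,c,d) \<in> S \<and> (a,b',c,d) \<in> S \<longrightarrow> b = b') \<and>
     (\<forall>a b c d c'. (a,b,c,d) \<in> S \<and> (a,b,c',d) \<in> S \<longrightarrow> c = c') \<and>
     (\<forall>a b c d d'. (a,b,c,d) \<in> S \<and> (a,b,c,d') \<in> S \<longrightarrow> d = d') \<and>
     (\<forall>a b c d a' b' c' d'. (a,b,c,d) \<in> S \<and> (a',b',c',d') \<in> S \<and>
        ((a',b',c,d) \<in> S \<and> (a,b,c',d') \<in> S \<or>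
         (a',b,c',d) \<in> S \<and> (a,b',c,d') \<in> S \<or>
         (a',b,c,d') \<in> S \<and> (a,b',c',d) \<in> S) \<longrightarrow>
        a = a' \<or> b = b' \<or> c = c' \<or> d = d')"

lemma exchange_free_coordinate_unique:
  assumes "exchange_free N S" "(a,b,c,d) \<in> S"
  shows "(a',b,c,d) \<in> S \<Longrightarrow> a = a'" "(a,b',c,d) \<in> S \<Longrightarrow> b = b'"
    "(a,b,c',d) \<in> S \<Longrightarrow> c = c'" "(a,b,c,d') \<in> S \<Longrightarrow> d = d'"
proof -
  note S = assms(1)[unfolded exchange_free_def]
  show "(a',b,c,d) \<in> S \<Longrightarrow> a = a'" using S[THEN conjunct2, THEN conjunct1] assms(2) by blast
  show "(a,b',c,d) \<in> S \<Longrightarrow> b = b'"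
    using S[THEN conjunct2, THEN conjunct2, THEN conjunct1] assms(2) by blast
  show "(a,b,c',d) \<in> S \<Longrightarrow> c = c'"
    using S[THEN conjunct2, THEN conjunct2, THEN conjunct2, THEN conjunct1] assms(2) by blast
  show "(a,b,c,d') \<in> S \<Longrightarrow> d = d'"
    using S[THEN conjunct2, THEN conjunct2, THEN conjunct2, THEN conjunct2, THEN conjunct1] assms(2)
    by blast
qed

lemma exchange_free_rectangle:
  assumes "exchange_free N S" "(a,b,c,d) \<in> S" "(a',b',c',d') \<in> S"
    "(a',b',c,d) \<in> S \<and> (a,b,c',d') \<in> S \<or>
     (a',b,c',d) \<in> S \<and> (a,b',c,d') \<in> S \<or>
     (a',b,c,d') \<in> S \<and> (a,b',c',d) \<in> S"
  shows "a = a' \<or> b = b' \<or> c = c' \<or> d = d'"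
  using assms(1)[unfolded exchange_free_def, THEN conjunct2, THEN conjunct2, THEN conjunct2,
      THEN conjunct2, THEN conjunct2, rule_format, OF conjI[OF assms(2) conjI[OF assms(3,4)]]] .

lemma small_multiple_eq_0:
  fixes x :: int
  assumes "int q dvd x" "\<bar>x\<bar> < int q"
  shows "x = 0"
  using assms dvd_imp_le_int[of x "int q"] by auto

lemma exchange_free_surface_points:
  assumes q: "prime q" "8 * N < q"
  shows "exchange_free N (surface_points N q t)"
proof -
  have pq: "prime (int q)" using q by simp
  \<comment> \<open>There are no zero divisors modulo \<open>q\<close>, and a factor smaller than
    \<open>q\<close> in absolute value that vanishes modulo \<open>q\<close> is zero. Each case
    below reduces to such a product.\<close>
  have mult0: "x = 0 \<or> y = 0"
    if "int q dvd x * y" "\<bar>x\<bar> < int q" "\<bar>y\<bar> < int q" for x y :: int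
    using that small_multiple_eq_0 prime_dvd_mult_iff[OF pq] by blast
  have diff: "int q dvd surface N a b c d - surface N a' b' c' d'"
    if "(a,b,c,d) \<in> surface_points N q t" "(a',b',c',d') \<in> surface_points N q t"
    for a b c d a' b' c' d'
    using that by (simp add: surface_points_def flip: mod_eq_dvd_iff)
  have bnd: "int a < int N" "int b < int N" "int c < int N" "int d < int N"
    "0 \<le> int a" "0 \<le> int b" "0 \<le> int c" "0 \<le> int d"
    if "(a,b,c,d) \<in> surface_points N q t" for a b c d
    using that by (auto simp: surface_points_def)
  have q2: "8 * int N < int q" using q(2) by simp
  have Da: "a = a'" if S: "(a,b,c,d) \<in> surface_points N q t" "(a',b,c,d) \<in> surface_points N q t"
    for a b c d a'
  proof -
    have "surface N a b c d - surface N a' b c d = (int a - int a') * (int b + 1 + int c)"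
      by (simp add: surface_def algebra_simps)
    with diff[OF S] have "int q dvd (int a - int a') * (int b + 1 + int c)" by simp
    then have "int a - int a' = 0 \<or> int b + 1 + int c = 0"
      by (rule mult0) (use bnd[OF S(1)] bnd[OF S(2)] q2 in linarith)+
    then show ?thesis using bnd[OF S(1)] bnd[OF S(2)] by linarith
  qed
  have Db: "b = b'" if S: "(a,b,c,d) \<in> surface_points N q t" "(a,b',c,d) \<in> surface_points N q t"
    for a b c d b'
  proof -
    have "surface N a b c d - surface N a b' c d =
        (int b - int b') * (int a + 2 * int N + int b + int b' + 2)"
      by (simp add: surface_def algebra_simps power2_eq_square)
    with diff[OF S] have "int q dvd (int b - int b') * (int a + 2 * int N + int b + int b' + 2)" by simp
    then have "int b - int b' = 0 \<or> int a + 2 * int N + int b + int b' + 2 = 0"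
      by (rule mult0) (use bnd[OF S(1)] bnd[OF S(2)] q2 in linarith)+
    then show ?thesis using bnd[OF S(1)] bnd[OF S(2)] by linarith
  qed
  have Dc: "c = c'" if S: "(a,b,c,d) \<in> surface_points N q t" "(a,b,c',d) \<in> surface_points N q t"
    for a b c d c'
  proof -
    have "surface N a b c d - surface N a b c' d =
        (int c - int c') * (int a + 2 * int N - int c - int c')"
      by (simp add: surface_def algebra_simps power2_eq_square)
    with diff[OF S] have "int q dvd (int c - int c') * (int a + 2 * int N - int c - int c')" by simp
    then have "int c - int c' = 0 \<or> int a + 2 * int N - int c - int c' = 0"
      by (rule mult0) (use bnd[OF S(1)] bnd[OF S(2)] q2 in linarith)+
    then show ?thesis using bnd[OF S(1)] bnd[OF S(2)] by linarith
  qed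
  have Dd: "d = d'" if S: "(a,b,c,d) \<in> surface_points N q t" "(a,b,c,d') \<in> surface_points N q t"
    for a b c d d'
  proof -
    have "surface N a b c d - surface N a b c d' = int d' - int d"
      by (simp add: surface_def)
    with diff[OF S] have "int q dvd int d' - int d" by simp
    then have "int d' - int d = 0"
      by (rule small_multiple_eq_0) (use bnd[OF S(1)] bnd[OF S(2)] q2 in linarith)
    then show ?thesis by simp
  qed
  have rect: "a = a' \<or> b = b' \<or> c = c' \<or> d = d'"
    if S: "(a,b,c,d) \<in> surface_points N q t" "(a',b',c',d') \<in> surface_points N q t"
    and alt: "(a',b',c,d) \<in> surface_points N q t \<and> (a,b,c',d') \<in> surface_points N q t \<or>
      (a',b,c',d) \<in> surface_points N q t \<and> (a,b',c,d') \<in> surface_points N q t \<or>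
      (a',b,c,d') \<in> surface_points N q t \<and> (a,b',c',d) \<in> surface_points N q t"
    for a b c d a' b' c' d'
    using alt
  proof (elim disjE conjE)
    assume T: "(a',b',c,d) \<in> surface_points N q t" "(a,b,c',d') \<in> surface_points N q t"
    \<comment> \<open>Summands involving coordinates from only one of the two pairs cancel in the
      alternating sum; only the mixed term a c survives. In the same way the next two cases retain a
      b and a (b + c).\<close>
    have "(surface N a b c d - surface N a' b' c d) - (surface N a b c' d' - surface N a' b' c' d') =
        (int a - int a') * (int c - int c')"
      by (simp add: surface_def algebra_simps)
    moreover have "int q dvd (surface N a b c d - surface N a' b' c d) -
        (surface N a b c' d' - surface N a' b' c' d')"
      by (intro dvd_diff diff S T)
    ultimately have "int q dvd (int a - int a') * (int c - int c')" by simp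
    then have "int a - int a' = 0 \<or> int c - int c' = 0"
      by (rule mult0) (use bnd[OF S(1)] bnd[OF S(2)] q2 in linarith)+
    then show ?thesis by auto
  next
    assume T: "(a',b,c',d) \<in> surface_points N q t" "(a,b',c,d') \<in> surface_points N q t"
    have "(surface N a b c d - surface N a' b c' d) - (surface N a b' c d' - surface N a' b' c' d') =
        (int a - int a') * (int b - int b')"
      by (simp add: surface_def algebra_simps)
    moreover have "int q dvd (surface N a b c d - surface N a' b c' d) -
        (surface N a b' c d' - surface N a' b' c' d')"
      by (intro dvd_diff diff S T)
    ultimately have "int q dvd (int a - int a') * (int b - int b')" by simp
    then have "int a - int a' = 0 \<or> int b - int b' = 0"
      by (rule mult0) (use bnd[OF S(1)] bnd[OF S(2)] q2 in linarith)+
    then show ?thesis by auto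
  next
    assume T: "(a',b,c,d') \<in> surface_points N q t" "(a,b',c',d) \<in> surface_points N q t"
    have "(surface N a b c d - surface N a' b c d') - (surface N a b' c' d - surface N a' b' c' d') =
        (int a - int a') * (int b + int c - int b' - int c')"
      by (simp add: surface_def algebra_simps)
    moreover have "int q dvd (surface N a b c d - surface N a' b c d') -
        (surface N a b' c' d - surface N a' b' c' d')"
      by (intro dvd_diff diff S T)
    ultimately have "int q dvd (int a - int a') * (int b + int c - int b' - int c')" by simp
    then have "int a - int a' = 0 \<or> int b + int c - int b' - int c' = 0"
      by (rule mult0) (use bnd[OF S(1)] bnd[OF S(2)] q2 in linarith)+
    then have "a = a' \<or> int b + int c = int b' + int c'" by auto
    \<comment> \<open>The points \<open>(a,b,c,d)\<close> and \<open>(a,b',c',d)\<close> now share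
      \<open>a\<close>, \<open>d\<close> and the sum b + c. Their difference is therefore that of (b
      + 1)^2 - c^2 = (b + 1 + c) (b + 1 - c), whose first factor is common to both.\<close>
    moreover have "b = b'" if e: "int b + int c = int b' + int c'"
    proof -
      have c: "int c = int b' + int c' - int b" using e by simp
      have "surface N a b c d - surface N a b' c' d =
          (int b + int c + 1) * (2 * (int b - int b'))"
        unfolding surface_def c by (simp add: algebra_simps power2_eq_square)
      with diff[OF S(1) T(2)] have "int q dvd (int b + int c + 1) * (2 * (int b - int b'))" by simp
      moreover have "\<bar>int b - int b'\<bar> < int N"
        using bnd[OF S(1)] bnd[OF S(2)] by linarith
      then have "\<bar>2 * (int b - int b')\<bar> < int q" using q2 by (simp add: abs_mult)
      moreover have "\<bar>int b + int c + 1\<bar> < int q"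
        using bnd[OF S(1)] q2 by linarith
      ultimately have "int b + int c + 1 = 0 \<or> 2 * (int b - int b') = 0"
        using mult0 by blast
      then show ?thesis using bnd(6,7)[OF S(1)] by auto
    qed
    ultimately show ?thesis by blast
  qed
  have sub: "surface_points N q t \<subseteq> {..<N} \<times> {..<N} \<times> {..<N} \<times> {..<N}"
    by (auto simp: surface_points_def)
  show ?thesis
    unfolding exchange_free_def
    by (intro conjI allI impI sub; elim conjE;
        (erule (1) Da | erule (1) Db | erule (1) Dc | erule (1) Dd | (rule rect, assumption+)))
qed

text \<open>Pigeonhole: the \<open>q\<close> residues partition the N^4 points of the box.\<close>

lemma exists_large_surface_points:
  assumes q: "q > 0"
  obtains t where "N ^ 4 \<le> q * card (surface_points N q t)"
proof -
  define B where "B = {..<N} \<times> {..<N} \<times> {..<N} \<times> {..<N}"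
  have fin: "finite B" by (simp add: B_def)
  have sub: "surface_points N q t \<subseteq> B" for t
    by (auto simp: surface_points_def B_def)
  have "B \<subseteq> (\<Union>t\<in>{0..<int q}. surface_points N q t)"
    using q by (auto simp: surface_points_def B_def)
  then have "card B \<le> card (\<Union>t\<in>{0..<int q}. surface_points N q t)"
    by (rule card_mono[rotated]) (use finite_subset[OF sub fin] in auto)
  also have "\<dots> \<le> (\<Sum>t\<in>{0..<int q}. card (surface_points N q t))"
    by (rule card_UN_le) simp
  finally have le: "N ^ 4 \<le> (\<Sum>t\<in>{0..<int q}. card (surface_points N q t))"
    by (simp add: B_def card_cartesian_product power4_eq_xxxx)
  have "\<exists>t. N ^ 4 \<le> q * card (surface_points N q t)"
  proof (rule ccontr)
    assume "\<not> ?thesis"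
    then have small: "q * card (surface_points N q t) < N ^ 4" for t by (simp add: not_le)
    have "q * (\<Sum>t\<in>{0..<int q}. card (surface_points N q t)) =
        (\<Sum>t\<in>{0..<int q}. q * card (surface_points N q t))"
      by (rule sum_distrib_left)
    also have "\<dots> < (\<Sum>t\<in>{0..<int q}. N ^ 4)"
      by (rule sum_strict_mono) (use q small in auto)
    also have "\<dots> = q * N ^ 4" by simp
    finally show False using le by simp
  qed
  then show thesis using that by blast
qed

section \<open>Sidon property of index multisets\<close>

text \<open>A multiset of indices stands for the product of the primes with these indices. The scale
  \<open>N = 2 ^ i\<close> owns the indices in \<open>[4N, 8N)\<close>, one quarter for each coordinate, so the scales use
  disjoint sets of primes.\<close>

fun word :: "nat \<Rightarrow> nat \<times> nat \<times> nat \<times> nat \<Rightarrow> nat multiset" where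
  "word N (a, b, c, d) = {#4 * N + a, 5 * N + b, 6 * N + c, 7 * N + d#}"

lemma size_word [simp]: "size (word N x) = 4"
  by (cases x) auto

lemma word_nonempty [simp]: "word N x \<noteq> {#}"
  by (cases x) auto

text \<open>Division by \<open>N\<close> tells which coordinate an index encodes, so filtering by
  the quotient splits an equation between words into one equation per coordinate.\<close>

lemma filter_digit_word:
  assumes "a < N" "b < N" "c < N" "d < N"
  shows "{#j \<in># word N (a,b,c,d). j div N = 4#} = {#4 * N + a#}"
    and "{#j \<in># word N (a,b,c,d). j div N = 5#} = {#5 * N + b#}"
    and "{#j \<in># word N (a,b,c,d). j div N = 6#} = {#6 * N + c#}"
    and "{#j \<in># word N (a,b,c,d). j div N = 7#} = {#7 * N + d#}"
proof -
  have "(k * N + e) div N = k" if "e < N" for k e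
    using that by (simp add: div_mult_self3)
  then show "{#j \<in># word N (a,b,c,d). j div N = 4#} = {#4 * N + a#}"
    and "{#j \<in># word N (a,b,c,d). j div N = 5#} = {#5 * N + b#}"
    and "{#j \<in># word N (a,b,c,d). j div N = 6#} = {#6 * N + c#}"
    and "{#j \<in># word N (a,b,c,d). j div N = 7#} = {#7 * N + d#}"
    using assms by simp_all
qed

text \<open>Blocks of different scales are disjoint dyadic intervals, so restricting an equation to
  one block keeps exactly the words of that scale.\<close>

lemma filter_block_word:
  assumes x: "x \<in> {..<2 ^ k} \<times> {..<2 ^ k} \<times> {..<2 ^ k} \<times> {..<2 ^ k}"
  shows "{#j \<in># word (2 ^ k) x. 4 * 2 ^ i \<le> j \<and> j < 8 * 2 ^ i#} =
    (if i = k then word (2 ^ k) x else {#})"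
proof -
  obtain a b c d where xe: "x = (a,b,c,d)" by (metis prod_cases4)
  have lt: "a < 2 ^ k" "b < 2 ^ k" "c < 2 ^ k" "d < 2 ^ k" using x xe by auto
  consider "i = k" | "i < k" | "k < i" by linarith
  then show ?thesis
  proof cases
    case 2
    then have "2 * 2 ^ i \<le> (2::nat) ^ k"
      by (metis power_Suc power_increasing Suc_leI one_le_numeral)
    then show ?thesis using 2 lt by (simp add: xe)
  next
    case 3
    then have "2 * 2 ^ k \<le> (2::nat) ^ i"
      by (metis power_Suc power_increasing Suc_leI one_le_numeral)
    then show ?thesis using 3 lt by (simp add: xe)
  qed (use lt in \<open>simp add: xe\<close>)
qed

lemma two_element_mset_eq:
  "{#a#} + {#b#} = {#c#} + {#d#} \<longleftrightarrow> a = c \<and> b = d \<or> a = d \<and> b = c"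
  by (auto simp: add_eq_conv_diff)

lemma word_inject:
  assumes "x \<in> {..<N} \<times> {..<N} \<times> {..<N} \<times> {..<N}" "y \<in> {..<N} \<times> {..<N} \<times> {..<N} \<times> {..<N}"
    "word N x = word N y"
  shows "x = y"
proof -
  obtain a b c d where x: "x = (a,b,c,d)" by (metis prod_cases4)
  obtain a' b' c' d' where y: "y = (a',b',c',d')" by (metis prod_cases4)
  have lt: "a < N" "b < N" "c < N" "d < N" "a' < N" "b' < N" "c' < N" "d' < N"
    using assms x y by auto
  have "{#j \<in># word N x. j div N = k#} = {#j \<in># word N y. j div N = k#}" for k
    using assms by simp
  from this[of 4] this[of 5] this[of 6] this[of 7] show ?thesis
    unfolding x y filter_digit_word[OF lt(1-4)] filter_digit_word[OF lt(5-8)] by simp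
qed

text \<open>Coordinatewise, \<open>u\<close> and \<open>v\<close> arise from \<open>x\<close> and
  \<open>y\<close> by swapping some of the four coordinates. Swapping one or three is excluded by
  coordinate uniqueness. Swapping two forms a rectangle, where one pair of equal coordinates reduces
  to the previous case.\<close>

lemma word_sidon_same_block:
  assumes S: "exchange_free N S" and xy: "x \<in> S" "y \<in> S" "u \<in> S" "v \<in> S"
    and eq: "word N x + word N y = word N u + word N v"
  shows "x = u \<and> y = v \<or> x = v \<and> y = u"
proof -
  obtain a b c d where x: "x = (a,b,c,d)" by (metis prod_cases4)
  obtain a' b' c' d' where y: "y = (a',b',c',d')" by (metis prod_cases4)
  obtain a1 b1 c1 d1 where u: "u = (a1,b1,c1,d1)" by (metis prod_cases4)
  obtain a2 b2 c2 d2 where v: "v = (a2,b2,c2,d2)" by (metis prod_cases4)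
  have "S \<subseteq> {..<N} \<times> {..<N} \<times> {..<N} \<times> {..<N}" using S by (simp add: exchange_free_def)
  then have lt: "a < N" "b < N" "c < N" "d < N" "a' < N" "b' < N" "c' < N" "d' < N"
    "a1 < N" "b1 < N" "c1 < N" "d1 < N" "a2 < N" "b2 < N" "c2 < N" "d2 < N"
    using xy x y u v by auto
  have "{#j \<in># word N x. j div N = k#} + {#j \<in># word N y. j div N = k#} =
      {#j \<in># word N u. j div N = k#} + {#j \<in># word N v. j div N = k#}" for k
    using arg_cong[OF eq, of "filter_mset (\<lambda>j. j div N = k)"] by simp
  from this[of 4] this[of 5] this[of 6] this[of 7]
  have sw: "a = a1 \<and> a' = a2 \<or> a = a2 \<and> a' = a1" "b = b1 \<and> b' = b2 \<or> b = b2 \<and> b' = b1"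
    "c = c1 \<and> c' = c2 \<or> c = c2 \<and> c' = c1" "d = d1 \<and> d' = d2 \<or> d = d2 \<and> d' = d1"
    unfolding x y u v filter_digit_word[OF lt(1-4)] filter_digit_word[OF lt(5-8)]
      filter_digit_word[OF lt(9-12)] filter_digit_word[OF lt(13-16)] two_element_mset_eq by simp_all
  have mem: "(a,b,c,d) \<in> S" "(a',b',c',d') \<in> S" "(a1,b1,c1,d1) \<in> S" "(a2,b2,c2,d2) \<in> S"
    using xy x y u v by auto
  have sw': "a1 = a \<and> a2 = a' \<or> a1 = a' \<and> a2 = a" "b1 = b \<and> b2 = b' \<or> b1 = b' \<and> b2 = b"
    "c1 = c \<and> c2 = c' \<or> c1 = c' \<and> c2 = c" "d1 = d \<and> d2 = d' \<or> d1 = d' \<and> d2 = d"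
    using sw by auto
  have "u = x \<or> u = y"
    using sw' mem(3,4) unfolding x y u
    by (elim disjE conjE; metis prod.inject exchange_free_coordinate_unique[OF S mem(1)]
      exchange_free_coordinate_unique[OF S mem(2)] exchange_free_rectangle[OF S mem(1,2)])
  then show ?thesis
    using sw unfolding x y u v by auto
qed

lemma word_sidon:
  assumes S: "\<And>i. exchange_free (2 ^ i) (S i)"
    and xy: "x \<in> S i" "y \<in> S j" "u \<in> S k" "v \<in> S l"
    and eq: "word (2 ^ i) x + word (2 ^ j) y = word (2 ^ k) u + word (2 ^ l) v"
  shows "word (2 ^ i) x = word (2 ^ k) u \<and> word (2 ^ j) y = word (2 ^ l) v \<or>
    word (2 ^ i) x = word (2 ^ l) v \<and> word (2 ^ j) y = word (2 ^ k) u"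
proof -
  have mem: "x \<in> {..<2 ^ n} \<times> {..<2 ^ n} \<times> {..<2 ^ n} \<times> {..<2 ^ n}" if "x \<in> S n" for x n
    using S[of n] that by (auto simp: exchange_free_def)
  note blk = filter_block_word[OF mem[OF xy(1)]] filter_block_word[OF mem[OF xy(2)]]
    filter_block_word[OF mem[OF xy(3)]] filter_block_word[OF mem[OF xy(4)]]
  have f: "(if n = i then word (2 ^ i) x else {#}) + (if n = j then word (2 ^ j) y else {#}) =
     (if n = k then word (2 ^ k) u else {#}) + (if n = l then word (2 ^ l) v else {#})" for n
    using arg_cong[OF eq, of "filter_mset (\<lambda>m. 4 * 2 ^ n \<le> m \<and> m < 8 * 2 ^ n)"]
    by (simp only: filter_union_mset blk)
  show ?thesis
  proof (cases "i = j")
    case True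
    have "k = i \<and> l = i"
      using arg_cong[OF f[of i], of size] True by (auto split: if_splits)
    then show ?thesis
      using word_sidon_same_block[OF S[of i], of x y u v] xy eq True by auto
  next
    case False
    \<comment> \<open>Block \<open>i\<close> holds exactly four letters on the left, hence exactly
      one word on the right; that word equals the first one and cancels.\<close>
    have "(i = k) \<noteq> (i = l)"
      using arg_cong[OF f[of i], of size] False by (auto split: if_splits)
    then have "word (2 ^ i) x = word (2 ^ k) u \<or> word (2 ^ i) x = word (2 ^ l) v"
      using f[of i] False by (auto split: if_splits)
    then show ?thesis using eq by (auto simp: add.commute)
  qed
qed

text \<open>This handles a product of four primes times a prime. One extra letter cannot supply a
  whole word, so the scales agree. The letter \<open>p\<close> affects at most one coordinate, and
  the other three determine it.\<close>

lemma word_add_single_cancel: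
  assumes S: "\<And>i. exchange_free (2 ^ i) (S i)"
    and xu: "x \<in> S i" "u \<in> S k"
    and eq: "word (2 ^ i) x + {#p#} = word (2 ^ k) u + {#r#}"
  shows "word (2 ^ i) x = word (2 ^ k) u \<and> p = r"
proof -
  have mem: "x \<in> {..<2 ^ n} \<times> {..<2 ^ n} \<times> {..<2 ^ n} \<times> {..<2 ^ n}" if "x \<in> S n" for x n
    using S[of n] that by (auto simp: exchange_free_def)
  have "size {#m \<in># word (2 ^ i) x. 4 * 2 ^ i \<le> m \<and> m < 8 * 2 ^ i#} \<le>
      size {#m \<in># word (2 ^ i) x + {#p#}. 4 * 2 ^ i \<le> m \<and> m < 8 * 2 ^ i#}"
    by simp
  then have "k = i"
    unfolding eq filter_union_mset filter_block_word[OF mem[OF xu(1)]]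
      filter_block_word[OF mem[OF xu(2)]]
    by (auto split: if_splits)
  define N :: nat where "N = 2 ^ i"
  obtain a b c d where x: "x = (a,b,c,d)" by (metis prod_cases4)
  obtain a' b' c' d' where u: "u = (a',b',c',d')" by (metis prod_cases4)
  have lt: "a < N" "b < N" "c < N" "d < N" "a' < N" "b' < N" "c' < N" "d' < N"
    using mem[OF xu(1)] mem[OF xu(2)] x u \<open>k = i\<close> by (auto simp: N_def)
  have f: "{#j \<in># word N x. j div N = n#} + {#j \<in># {#p#}. j div N = n#} =
      {#j \<in># word N u. j div N = n#} + {#j \<in># {#r#}. j div N = n#}" for n
    using eq \<open>k = i\<close> unfolding filter_union_mset[symmetric] N_def by simp
  have *: "p div N \<noteq> 4 \<Longrightarrow> a = a'" "p div N \<noteq> 5 \<Longrightarrow> b = b'"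
    "p div N \<noteq> 6 \<Longrightarrow> c = c'" "p div N \<noteq> 7 \<Longrightarrow> d = d'"
    using f[of 4] f[of 5] f[of 6] f[of 7]
      arg_cong[OF f[of 4], of size] arg_cong[OF f[of 5], of size]
      arg_cong[OF f[of 6], of size] arg_cong[OF f[of 7], of size]
    unfolding x u filter_digit_word[OF lt(1-4)] filter_digit_word[OF lt(5-8)]
    by (auto split: if_splits)
  have "x = u"
  proof -
    have Sx: "(a,b,c,d) \<in> S i" "(a',b',c',d') \<in> S i" using xu x u \<open>k = i\<close> by auto
    consider "b = b' \<and> c = c' \<and> d = d'" | "a = a' \<and> c = c' \<and> d = d'"
      | "a = a' \<and> b = b' \<and> d = d'" | "a = a' \<and> b = b' \<and> c = c'"
      using * by (cases "p div N = 4"; cases "p div N = 5"; cases "p div N = 6") auto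
    then show ?thesis
      using Sx(2) exchange_free_coordinate_unique[OF S[of i] Sx(1)] unfolding x u
      by cases metis+

  qed
  then show ?thesis using eq \<open>k = i\<close> by simp
qed

definition words :: "(nat \<Rightarrow> (nat \<times> nat \<times> nat \<times> nat) set) \<Rightarrow> nat multiset set" where
  "words S = range (\<lambda>j. {#j#}) \<union> (\<Union>i. word (2 ^ i) ` S i)"

text \<open>The total size 2, 5 or 8 fixes how many four-letter words occur on each side, leaving
  one case for each number of such words.\<close>

lemma words_sidon:
  assumes S: "\<And>i. exchange_free (2 ^ i) (S i)"
    and M: "M1 \<in> words S" "M2 \<in> words S" "M3 \<in> words S" "M4 \<in> words S"
    and eq: "M1 + M2 = M3 + M4"
  shows "M1 = M3 \<and> M2 = M4 \<or> M1 = M4 \<and> M2 = M3"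
proof -
  define W where "W = (\<Union>i. word (2 ^ i) ` S i)"
  have WW: "M = M'' \<and> M' = M''' \<or> M = M''' \<and> M' = M''"
    if "M \<in> W" "M' \<in> W" "M'' \<in> W" "M''' \<in> W" "M + M' = M'' + M'''" for M M' M'' M'''
    using that word_sidon[OF S] unfolding W_def by blast
  have W1: "M = M' \<and> p = r" if "M \<in> W" "M' \<in> W" "M + {#p#} = M' + {#r#}" for M M' p r
    using that word_add_single_cancel[OF S] unfolding W_def by blast
  have sz: "size M = 4" if "M \<in> W" for M using that by (auto simp: W_def)
  have cs: "M \<in> W \<or> (\<exists>j. M = {#j#})" if "M \<in> words S" for M
    using that by (auto simp: words_def W_def)
  have s: "size M1 + size M2 = size M3 + size M4"
    using arg_cong[OF eq, of size] by simp
  consider "M1 \<in> W" "M2 \<in> W" | p where "M1 \<in> W" "M2 = {#p#}" | p where "M1 = {#p#}" "M2 \<in> W"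
    | p p' where "M1 = {#p#}" "M2 = {#p'#}"
    using cs[OF M(1)] cs[OF M(2)] by blast
  note c1 = this
  consider "M3 \<in> W" "M4 \<in> W" | p where "M3 \<in> W" "M4 = {#p#}" | p where "M3 = {#p#}" "M4 \<in> W"
    | p p' where "M3 = {#p#}" "M4 = {#p'#}"
    using cs[OF M(3)] cs[OF M(4)] by blast
  note c2 = this
  show ?thesis
  proof (cases rule: c1)
    case 1
    then show ?thesis using s sz WW eq by (cases rule: c2) auto
  next
    case (2 p)
    show ?thesis
    proof (cases rule: c2)
      case (2 r)
      then show ?thesis using W1[of M1 M3 p r] eq \<open>M1 \<in> W\<close> \<open>M2 = {#p#}\<close> by simp
    next
      case (3 r)
      then show ?thesis using W1[of M1 M4 p r] eq \<open>M1 \<in> W\<close> \<open>M2 = {#p#}\<close> by (simp add: add.commute)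
    qed (use 2 s sz in auto)
  next
    case (3 p)
    show ?thesis
    proof (cases rule: c2)
      case (2 r)
      then show ?thesis using W1[of M2 M3 p r] eq \<open>M2 \<in> W\<close> \<open>M1 = {#p#}\<close> by (simp add: add.commute)
    next
      case (3 r)
      then show ?thesis using W1[of M2 M4 p r] eq \<open>M2 \<in> W\<close> \<open>M1 = {#p#}\<close> by (simp add: add.commute)
    qed (use 3 s sz in auto)
  next
    case (4 p p')
    show ?thesis
    proof (cases rule: c2)
      case (4 r r')
      then have "{#p#} + {#p'#} = {#r#} + {#r'#}"
        using eq \<open>M1 = {#p#}\<close> \<open>M2 = {#p'#}\<close> by (simp only:)
      then show ?thesis
        using 4 \<open>M1 = {#p#}\<close> \<open>M2 = {#p'#}\<close> unfolding two_element_mset_eq by auto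
    qed (use 4 s sz in auto)
  qed
qed

section \<open>The Sidon set\<close>

abbreviation nth_prime :: "nat \<Rightarrow> nat" where
  "nth_prime \<equiv> enumerate {p. prime p}"

definition prime_product :: "nat multiset \<Rightarrow> nat" where
  "prime_product M = \<Prod>\<^sub># (image_mset nth_prime M)"

lemma infinite_primes: "infinite {p::nat. prime p}"
  using primes_infinite by simp

lemma prime_enumerate: "prime (nth_prime j)"
  using enumerate_in_set[OF infinite_primes] by simp

lemma ex_nth_prime:
  assumes "prime p"
  obtains j where "nth_prime j = p"
  using enumerate_Ex[OF infinite_primes] assms by blast

lemma prime_product_add: "prime_product (M + M') = prime_product M * prime_product M'"
  by (simp add: prime_product_def)

lemma prime_product_single [simp]: "prime_product {#j#} = nth_prime j"
  by (simp add: prime_product_def)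

text \<open>Unique factorization makes the multiplicative Sidon condition on the products an
  additive one on multisets.\<close>

lemma prime_product_inject [simp]: "prime_product M = prime_product M' \<longleftrightarrow> M = M'"
proof
  have pf: "prime_factorization (prime_product M) = image_mset nth_prime M" for M
    unfolding prime_product_def
    by (rule prime_factorization_prod_mset_primes) (auto simp: prime_enumerate)
  have "inj nth_prime"
    by (rule inj_enumerate[OF infinite_primes])
  moreover assume "prime_product M = prime_product M'"
  then have "image_mset nth_prime M = image_mset nth_prime M'"
    using pf by metis
  ultimately show "M = M'" by (simp add: multiset.inj_map inj_eq)
qed simp

lemma prime_product_pos: "prime_product M > 0"
  unfolding prime_product_def
  by (auto simp: prod_mset_zero_iff neq0_conv[symmetric] simp del: neq0_conv)
     (metis not_prime_0 prime_enumerate)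

lemma multiplicative_Sidon_words:
  assumes "\<And>i. exchange_free (2 ^ i) (S i)"
  shows "multiplicative_Sidon (prime_product ` words S)"
  unfolding multiplicative_Sidon_def
proof (intro conjI allI ballI impI)
  fix s x y u v
  assume "x \<in> prime_product ` words S" "y \<in> prime_product ` words S"
    "u \<in> prime_product ` words S" "v \<in> prime_product ` words S" and s: "x * y = s \<and> u * v = s"
  then obtain M1 M2 M3 M4 where M: "M1 \<in> words S" "M2 \<in> words S" "M3 \<in> words S" "M4 \<in> words S"
    "x = prime_product M1" "y = prime_product M2" "u = prime_product M3" "v = prime_product M4"
    by auto
  have "prime_product (M1 + M2) = prime_product (M3 + M4)"
    using s M by (simp add: prime_product_add)
  then have "M1 + M2 = M3 + M4" by simp
  from words_sidon[OF assms M(1-4) this] show "x = u \<and> y = v \<or> x = v \<and> y = u"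
    using M by auto
qed (auto simp: prime_product_pos)

text \<open>For N = 2^i a prime with 8N < q <= 32N yields a surface of size at least N^4 / q >= N^3
  / 32. The prime is available when i + 3 >= 7; smaller scales stay empty.\<close>

lemma exists_exchange_free_family:
  obtains S where "\<And>i. exchange_free (2 ^ i) (S i)" "\<And>i. i \<ge> 4 \<Longrightarrow> 2 ^ (3 * i) \<le> 32 * card (S i)"
proof -
  have "\<exists>T. exchange_free (2 ^ i) T \<and> (i \<ge> 4 \<longrightarrow> 2 ^ (3 * i) \<le> 32 * card T)" for i
  proof (cases "i \<ge> 4")
    case True
    obtain q :: nat where q: "prime q" "2 ^ (i + 3) < q" "q \<le> 2 ^ (i + 3 + 2)"
      by (rule prime_between_two_powers[of "i + 3"]) (use True in auto)
    obtain t where t: "(2 ^ i) ^ 4 \<le> q * card (surface_points (2 ^ i) q t)"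
      using exists_large_surface_points[of q "2 ^ i"] q(1) prime_gt_0_nat by blast
    have "2 ^ i * 2 ^ (3 * i) = ((2::nat) ^ i) ^ 4"
      by (simp add: mult.commute flip: power_add power_mult)
    also have "\<dots> \<le> (2 ^ i * 32) * card (surface_points (2 ^ i) q t)"
      by (rule order_trans[OF t mult_le_mono1]) (use q(3) in \<open>simp add: power_add\<close>)
    finally have "2 ^ i * 2 ^ (3 * i) \<le> 2 ^ i * (32 * card (surface_points (2 ^ i) q t))"
      by (simp only: mult.assoc)
    then have "2 ^ (3 * i) \<le> 32 * card (surface_points (2 ^ i) q t)"
      by simp
    moreover have "exchange_free (2 ^ i) (surface_points (2 ^ i) q t)"
      by (rule exchange_free_surface_points) (use q in \<open>simp_all add: power_add\<close>)
    ultimately show ?thesis by blast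
  next
    case False
    have "exchange_free (2 ^ i) {}" by (simp add: exchange_free_def)
    then show ?thesis using False by blast
  qed
  then obtain S where "\<And>i. exchange_free (2 ^ i) (S i) \<and> (i \<ge> 4 \<longrightarrow> 2 ^ (3 * i) \<le> 32 * card (S i))"
    by metis
  then show thesis using that by blast
qed

text \<open>Indices start at 0, hence the strict inequality. If the prime with index
  \<open>j\<close> exceeded \<open>x\<close>, all primes up to \<open>x\<close> would have indices
  below \<open>j\<close>.\<close>

lemma enumerate_primes_le:
  assumes "j < prime_counting x"
  shows "nth_prime j \<le> x"
proof (rule ccontr)
  assume "\<not> ?thesis"
  then have gt: "x < nth_prime j" by simp
  have "{p. prime p \<and> p \<le> x} \<subseteq> nth_prime ` {..<j}"
  proof
    fix p assume p: "p \<in> {p. prime p \<and> p \<le> x}"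
    then obtain l where l: "nth_prime l = p"
      using ex_nth_prime by auto
    then have "nth_prime l < nth_prime j" using p gt by simp
    then have "l < j" by (simp add: infinite_primes)
    then show "p \<in> nth_prime ` {..<j}" using l by auto
  qed
  then have "prime_counting x \<le> card (nth_prime ` {..<j})"
    unfolding prime_counting_def by (intro card_mono) auto
  also have "\<dots> \<le> j" using card_image_le[of "{..<j}"] by simp
  finally show False using assms by simp
qed

lemma prime_product_word_not_prime: "\<not> prime (prime_product (word N x))"
proof
  assume "prime (prime_product (word N x))"
  then obtain j where "prime_product (word N x) = prime_product {#j#}"
    using ex_nth_prime by (metis prime_product_single)
  then have "size (word N x) = size {#j#}" by (simp only: prime_product_inject)
  then show False by simp
qed

text \<open>All indices of scale \<open>i\<close> are below 8 * 2^i, so the four primes are at most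
  \<open>x\<close> and the product at most x^4. These products are distinct and not prime, so they
  add to the count of primes.\<close>

lemma counting_words_ge:
  assumes S: "\<And>i. exchange_free (2 ^ i) (S i)"
    and i: "8 * 2 ^ i \<le> prime_counting x" and n: "x ^ 4 \<le> n"
  shows "prime_counting n + card (S i) \<le> counting (prime_product ` words S) n"
proof -
  define W where "W = (\<lambda>y. prime_product (word (2 ^ i) y)) ` S i"
  have box: "S i \<subseteq> {..<2 ^ i} \<times> {..<2 ^ i} \<times> {..<2 ^ i} \<times> {..<2 ^ i}"
    using S[of i] by (simp add: exchange_free_def)
  have fin: "finite W" unfolding W_def using finite_subset[OF box] by simp
  have "card W = card (S i)"
    unfolding W_def
  proof (rule card_image, rule inj_onI)
    fix y z assume "y \<in> S i" "z \<in> S i"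
      and "prime_product (word (2 ^ i) y) = prime_product (word (2 ^ i) z)"
    then show "y = z" using word_inject[of y "2 ^ i" z] box by auto
  qed
  moreover have "W \<inter> {p. prime p \<and> p \<le> n} = {}"
    using prime_product_word_not_prime by (auto simp: W_def)
  ultimately have "prime_counting n + card (S i) = card ({p. prime p \<and> p \<le> n} \<union> W)"
    using fin by (subst card_Un_disjoint) (auto simp: prime_counting_def)
  also have "\<dots> \<le> card (prime_product ` words S \<inter> {1..n})"
  proof (rule card_mono)
    have "p \<in> prime_product ` words S" if p: "prime p" for p
    proof -
      obtain j where "nth_prime j = p"
        using ex_nth_prime p by blast
      then have "p = prime_product {#j#}" by simp
      then show ?thesis unfolding words_def by blast
    qed
    moreover have "W \<subseteq> prime_product ` words S" by (auto simp: W_def words_def)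
    moreover have "w \<le> n" if w: "w \<in> W" for w
    proof -
      obtain a b c d where y: "(a,b,c,d) \<in> S i" "w = prime_product (word (2 ^ i) (a,b,c,d))"
        using w unfolding W_def by auto
      let ?P = nth_prime
      have lt: "a < 2 ^ i" "b < 2 ^ i" "c < 2 ^ i" "d < 2 ^ i" using y box by auto
      have "w = ?P (4 * 2 ^ i + a) * (?P (5 * 2 ^ i + b) * (?P (6 * 2 ^ i + c) * ?P (7 * 2 ^ i + d)))"
        unfolding y(2) by (simp add: prime_product_def)
      also have "\<dots> \<le> x * (x * (x * x))"
        by (intro mult_le_mono enumerate_primes_le) (use lt i in linarith)+
      also have "\<dots> = x ^ 4" by (simp add: power4_eq_xxxx mult.assoc)
      finally show ?thesis using n by simp
    qed
    moreover have "w > 0" if "w \<in> W" for w using that by (auto simp: W_def prime_product_pos)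
    ultimately show "{p. prime p \<and> p \<le> n} \<union> W \<subseteq> prime_product ` words S \<inter> {1..n}"
      by (auto simp: Suc_le_eq prime_gt_0_nat)
  qed simp
  finally show ?thesis by (simp add: counting_def)
qed

section \<open>Choice of scale and comparison of constants\<close>

lemma two_power_gt_mult_128:
  "k \<ge> 11 \<Longrightarrow> 128 * k < 2 ^ k" for k :: nat
proof (induction k rule: dec_induct)
  case (step k)
  then show ?case by simp
qed simp

lemma counting_words_lower:
  assumes S: "\<And>i. exchange_free (2 ^ i) (S i)" "\<And>i. i \<ge> 4 \<Longrightarrow> 2 ^ (3 * i) \<le> 32 * card (S i)"
    and k: "k \<ge> 11" "16 ^ k \<le> n"
  shows "prime_counting n + real (8 ^ k) / (131072 * real k ^ 3) \<le> counting (prime_product ` words S) n"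
proof -
  define m where "m = prime_counting (2 ^ k)"
  have low: "2 ^ k \<le> k * m + 1"
    using prime_counting_two_power_lower[of k] k by (simp add: m_def)
  have "128 * k < k * m + 1" using two_power_gt_mult_128[OF k(1)] low by linarith
  \<comment> \<open>The value 128 = 8 * 16 forces i >= 4 for the scale chosen below, where
    \<open>S i\<close> is known to be large.\<close>
  have m: "128 \<le> m"
  proof (rule ccontr)
    assume "\<not> 128 \<le> m"
    then have "k * (m + 1) \<le> k * 128" by (intro mult_le_mono2) simp
    then have "k * m + k \<le> k * 128" by (simp only: distrib_left mult_1_right)
    then show False using \<open>128 * k < k * m + 1\<close> k(1) by linarith
  qed
  have m8: "16 \<le> m div 8" using div_le_mono[OF m, of 8] by simp
  then obtain i where i: "2 ^ i \<le> m div 8" "m div 8 < 2 ^ (i + 1)"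
    using ex_power_ivl1[of 2 "m div 8"] by auto
  have i8: "8 * 2 ^ i \<le> m" "m + 1 \<le> 16 * 2 ^ i" using i by (auto simp: less_mult_imp_div_less)
  have "i \<ge> 4"
  proof (rule ccontr)
    assume "\<not> i \<ge> 4"
    then have "(2::nat) ^ (i + 1) \<le> 2 ^ 4" by (intro power_increasing) auto
    then show False using i m8 by simp
  qed
  have "(2 ^ k) ^ 4 = ((2::nat) ^ 4) ^ k" by (simp only: mult.commute flip: power_mult)
  then have k16: "(2 ^ k) ^ 4 \<le> n" using k(2) by simp
  have "(2 ^ i) ^ 3 = (2::nat) ^ (3 * i)" by (simp only: mult.commute flip: power_mult)
  then have cS: "(2 ^ i) ^ 3 \<le> 32 * card (S i)" using S(2)[OF \<open>i \<ge> 4\<close>] by (simp only:)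
  \<comment> \<open>The maximal choice of \<open>i\<close> loses only a bounded factor: 2^k <= 16 k
    2^i. Cubing and the density 1/32 give 16^3 * 32 = 131072.\<close>
  have "2 ^ k \<le> k * (m + 1)" using low k by simp
  also have "\<dots> \<le> k * (16 * 2 ^ i)" using i8 by (intro mult_le_mono2)
  finally have "(2 ^ k) ^ 3 \<le> (k * (16 * 2 ^ i)) ^ 3" by (rule power_mono) simp
  also have "\<dots> = k ^ 3 * 4096 * (2 ^ i) ^ 3" by (simp add: power_mult_distrib)
  also have "\<dots> \<le> k ^ 3 * 4096 * (32 * card (S i))"
    using cS by (rule mult_le_mono2)
  also have "(2 ^ k) ^ 3 = ((2::nat) ^ 3) ^ k" by (simp only: mult.commute flip: power_mult)
  finally have "8 ^ k \<le> k ^ 3 * 131072 * card (S i)" by simp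
  then have "real (8 ^ k) \<le> real (k ^ 3 * 131072 * card (S i))" by (simp only: of_nat_le_iff)
  then have "real (8 ^ k) / (131072 * real k ^ 3) \<le> card (S i)"
    using k by (simp add: field_simps)
  moreover have "prime_counting n + card (S i) \<le> counting (prime_product ` words S) n"
    by (rule counting_words_ge[OF S(1) _ k16]) (use i8(1) in \<open>simp only: m_def\<close>)
  ultimately show ?thesis by linarith
qed

text \<open>Here ln n >= 4 k ln 2 >= (8/3) k, whose cube is at least 16 k^3 because 512/27 > 16, and
  n^(3/4) <= 8^(k + 1). The quotient is at most 8^k / (2 k^3), and 131072 / 2 = 65536.\<close>

lemma powr_div_ln_cube_upper:
  assumes "k \<ge> 1" "16 ^ k \<le> n" "n < 16 ^ (k + 1)"
  shows "real n powr (3/4) / ln (real n) ^ 3 \<le> 65536 * (8 ^ k / (131072 * real k ^ 3))"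
proof -
  have "(16::real) ^ k \<le> real n" using assms(2) by (metis of_nat_le_iff of_nat_numeral of_nat_power)
  then have "ln ((16::real) ^ k) \<le> ln (real n)"
    using order_less_le_trans[OF _ assms(2), of 0] by (subst ln_le_cancel_iff) auto
  moreover have "ln ((16::real) ^ k) = 4 * real k * ln 2"
    using ln_realpow[of 2 4] by (simp add: ln_realpow)
  moreover have "real k * (2/3) \<le> real k * ln 2" using ln2_ge_two_thirds by (intro mult_left_mono) auto
  ultimately have "8/3 * real k \<le> ln (real n)" by linarith
  then have "(8/3 * real k) ^ 3 \<le> ln (real n) ^ 3" by (rule power_mono) simp
  then have l: "16 * real k ^ 3 \<le> ln (real n) ^ 3"
    by (simp add: power_mult_distrib power_divide) (smt (verit) zero_le_power of_nat_0_le_iff)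
  have "real n \<le> 16 ^ (k + 1)" using assms(3)
    by (metis less_imp_le of_nat_le_iff of_nat_numeral of_nat_power)
  then have "real n powr (3/4) \<le> (16 ^ (k + 1)) powr (3/4)" by (intro powr_mono2) auto
  also have "(16::real) ^ (k + 1) = (2 ^ 4) ^ (k + 1)" by simp
  also have "\<dots> = (2 ^ (k + 1)) ^ 4" by (simp only: mult.commute flip: power_mult)
  also have "\<dots> = (2 ^ (k + 1)) powr 4" by (rule powr_numeral[symmetric]) simp
  also have "\<dots> powr (3/4) = (2 ^ (k + 1)) powr 3" by (subst powr_powr) simp
  also have "\<dots> = (2 ^ (k + 1)) ^ 3" by (rule powr_numeral) simp
  also have "\<dots> = (2 ^ 3) ^ (k + 1)" by (simp only: mult.commute flip: power_mult)
  finally have p: "real n powr (3/4) \<le> 8 * 8 ^ k" by simp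
  have "real n powr (3/4) / ln (real n) ^ 3 \<le> 8 * 8 ^ k / (16 * real k ^ 3)"
    using p l assms by (intro frac_le) auto
  also have "\<dots> = 65536 * (8 ^ k / (131072 * real k ^ 3))" by simp
  finally show ?thesis .
qed

theorem theorem3:
  shows "\<exists>A::nat set. multiplicative_Sidon A \<and>
    liminf (\<lambda>n::nat. ereal ((real (counting A n) - real (prime_counting n)) /
                     (real n powr (3/4) / (ln (real n)) ^ 3)))
      > ereal (1 / 196608)"
proof -
  obtain S where S: "\<And>i. exchange_free (2 ^ i) (S i)"
    "\<And>i. i \<ge> 4 \<Longrightarrow> 2 ^ (3 * i) \<le> 32 * card (S i)"
    using exists_exchange_free_family by blast
  define A where "A = prime_product ` words S"
  \<comment> \<open>The threshold 16^11 guarantees k >= 11. Strictness of the final inequality comes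
    from the constant, as 196608 = 3 * 65536.\<close>
  have "1 / 65536 \<le> (real (counting A n) - real (prime_counting n)) /
      (real n powr (3/4) / (ln (real n)) ^ 3)" if n: "n \<ge> 16 ^ 11" for n
  proof -
    obtain k where k: "16 ^ k \<le> n" "n < 16 ^ (k + 1)"
      using ex_power_ivl1[of 16 n] n by auto
    have "(16::nat) ^ 11 < 16 ^ (k + 1)" using n k by linarith
    then have k11: "k \<ge> 11" by (subst (asm) power_strict_increasing_iff) auto
    have "real n powr (3/4) / ln (real n) ^ 3 \<le> 65536 * (8 ^ k / (131072 * real k ^ 3))"
      by (rule powr_div_ln_cube_upper) (use k k11 in auto)
    also have "\<dots> \<le> 65536 * (real (counting A n) - real (prime_counting n))"
      using counting_words_lower[OF S k11 k(1)] by (simp add: A_def)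
    finally have le: "real n powr (3/4) / ln (real n) ^ 3 \<le>
      65536 * (real (counting A n) - real (prime_counting n))" .
    have "n > 1" using n by simp
    then have "real n powr (3/4) / ln (real n) ^ 3 > 0" by simp
    moreover have "1 / 65536 \<le> D / C" if "C > 0" "C \<le> 65536 * D" for C D :: real
      using that by (simp add: field_simps)
    ultimately show ?thesis using le by blast
  qed
  then have "ereal (1 / 65536) \<le> liminf (\<lambda>n::nat. ereal ((real (counting A n) - real (prime_counting n)) /
      (real n powr (3/4) / (ln (real n)) ^ 3)))"
    by (intro Liminf_bounded eventually_sequentiallyI[of "16 ^ 11"]) (simp only: ereal_less_eq)
  moreover have "ereal (1 / 196608) < ereal (1 / 65536)" by simp
  moreover have "multiplicative_Sidon A" unfolding A_def by (rule multiplicative_Sidon_words[OF S(1)])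
  ultimately show ?thesis by (meson order_less_le_trans)
qed

end
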